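(* Let $G$ be a finite group, $A$ a finite set with $|A|\ge 2$, $a\in A$, $A'=A\setminus\{a\}$, and $N$ a non-empty subset of $\mathbb{Z}_{\ge 0}$. For any subgroup $H$ of $G$ and any finite $G$-set $X$, \[\varphi_{H,t}(J_{N,A,a}(X))=\prod_{i=1}^{\infty}\Big(\sum_{n\in N}(|A'|t^i)^n\Big)^{O_{X,H,i}},\] where $O_{X,H,i}$ is the number of $H$-orbits $Hx\subset X$ (for $X$ regarded as an $H$-set) with $|Hx|=i$.
   Context: For $n\ge1$ let $A'^{[n]}$ be the set of maps $\{1,\dots,n\}\to A'$, and $A'^{[0]}=\{a\}$; an element of $A'^{[n]}$ has degree $n$. Let $S_N=\bigsqcup_{n\in N}A'^{[n]}$ with trivial $G$-action. $J_{N,A,a}(X)=S_N^X$ is the set of maps $f:X\to S_N$ with action $(gf)(x)=f(g^{-1}x)$; $\deg(f)=\sum_{x\in X}\deg(f(x))$ and $J^n_{N,A,a}(X)=\{f:\deg(f)=n\}$, a finite $G$-set. For a finite $G$-set $Z$, $\varphi_H(Z)$ is the number of points of $Z$ fixed by every element of $H$. $\varphi_{H,t}(J_{N,A,a}(X))=\sum_{n\ge0}\varphi_H(J^n_{N,A,a}(X))t^n$, a formal power series in $t$. *)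

theory Defs
  imports "HOL-Analysis.Analysis" "HOL-Algebra.Group_Action"
    "HOL-Computational_Algebra.Formal_Power_Series"
begin

text \<open>
  Throughout, a \<open>G\<close>-set is a set \<open>X\<close> with an action \<open>\<phi>\<close> in the sense of \<^locale>\<open>group_action\<close>.
\<close>

text \<open>
  \<open>A'\<^sup>[\<^sup>n\<^sup>]\<close>: for \<open>n = 0\<close> it is the one-element set \<open>{a}\<close>, for \<open>n \<ge> 1\<close> a set of maps;
  the sum type accommodates both.
\<close>

definition bracket_power :: "'a set \<Rightarrow> 'a \<Rightarrow> nat \<Rightarrow> ('a + (nat \<Rightarrow> 'a)) set" where
  "bracket_power A a n =
     (if n = 0 then Inl ` {a} else Inr ` ({1..n} \<rightarrow>\<^sub>E (A - {a})))"

text \<open>The disjoint union; the tag of an element is its degree.\<close>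

definition S_set :: "nat set \<Rightarrow> 'a set \<Rightarrow> 'a \<Rightarrow> (nat \<times> ('a + (nat \<Rightarrow> 'a))) set" where
  "S_set N A a = (SIGMA n:N. bracket_power A a n)"

definition deg :: "'x set \<Rightarrow> ('x \<Rightarrow> nat \<times> 's) \<Rightarrow> nat" where
  "deg X f = (\<Sum>x\<in>X. fst (f x))"

definition J_set ::
  "nat set \<Rightarrow> 'a set \<Rightarrow> 'a \<Rightarrow> 'x set \<Rightarrow> ('x \<Rightarrow> nat \<times> ('a + (nat \<Rightarrow> 'a))) set" where
  "J_set N A a X = (X \<rightarrow>\<^sub>E S_set N A a)"

definition J_deg ::
  "nat set \<Rightarrow> 'a set \<Rightarrow> 'a \<Rightarrow> 'x set \<Rightarrow> nat \<Rightarrow> ('x \<Rightarrow> nat \<times> ('a + (nat \<Rightarrow> 'a))) set" where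
  "J_deg N A a X n = {f \<in> J_set N A a X. deg X f = n}"

text \<open>
  The action \<open>(g f)(x) = f (g\<inverse> x)\<close> on a set \<open>Z\<close> of maps on \<open>X\<close>. Both restrictions are needed
  because \<^const>\<open>BijGroup\<close> consists of extensional functions.
\<close>

definition map_action ::
  "('g, 'm) monoid_scheme \<Rightarrow> 'x set \<Rightarrow> ('g \<Rightarrow> 'x \<Rightarrow> 'x) \<Rightarrow> ('x \<Rightarrow> 's) set
     \<Rightarrow> 'g \<Rightarrow> ('x \<Rightarrow> 's) \<Rightarrow> ('x \<Rightarrow> 's)" where
  "map_action G X \<phi> Z g = (\<lambda>f\<in>Z. \<lambda>x\<in>X. f (\<phi> (inv\<^bsub>G\<^esub> g) x))"

definition mark :: "'g set \<Rightarrow> 'z set \<Rightarrow> ('g \<Rightarrow> 'z \<Rightarrow> 'z) \<Rightarrow> nat" where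
  "mark H Z \<psi> = card {z \<in> Z. \<forall>h\<in>H. \<psi> h z = z}"

definition mark_series ::
  "('g, 'm) monoid_scheme \<Rightarrow> 'x set \<Rightarrow> ('g \<Rightarrow> 'x \<Rightarrow> 'x) \<Rightarrow> 'g set
     \<Rightarrow> nat set \<Rightarrow> 'a set \<Rightarrow> 'a \<Rightarrow> int fps" where
  "mark_series G X \<phi> H N A a =
     Abs_fps (\<lambda>n. int (mark H (J_deg N A a X n) (map_action G X \<phi> (J_deg N A a X n))))"

definition orbit_count ::
  "('g, 'm) monoid_scheme \<Rightarrow> 'x set \<Rightarrow> ('g \<Rightarrow> 'x \<Rightarrow> 'x) \<Rightarrow> 'g set \<Rightarrow> nat \<Rightarrow> nat" where
  "orbit_count G X \<phi> H i = card {U \<in> orbits (G\<lparr>carrier := H\<rparr>) X \<phi>. card U = i}"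

text \<open>\<open>J_deg\<close> is indeed a finite \<open>G\<close>-set.\<close>

lemma finite_J_deg:
  assumes "finite X" "finite A"
  shows "finite (J_deg N A a X n)"
proof (rule finite_subset)
  show "J_deg N A a X n \<subseteq> (X \<rightarrow>\<^sub>E (SIGMA k:{..n}. bracket_power A a k))"
  proof
    fix f assume f: "f \<in> J_deg N A a X n"
    have "fst (f x) \<le> n" if "x \<in> X" for x
      using f member_le_sum[OF that, of "\<lambda>x. fst (f x)"] assms
      by (auto simp: J_deg_def deg_def)
    moreover have "f x \<in> S_set N A a" if "x \<in> X" for x
      using f that by (auto simp: J_deg_def J_set_def)
    ultimately have "f x \<in> (SIGMA k:{..n}. bracket_power A a k)" if "x \<in> X" for x
      using that by (fastforce simp: S_set_def)
    moreover have "f \<in> extensional X"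
      using f by (auto simp: J_deg_def J_set_def PiE_def)
    ultimately show "f \<in> (X \<rightarrow>\<^sub>E (SIGMA k:{..n}. bracket_power A a k))"
      by (auto simp: PiE_def Pi_def)
  qed
  show "finite (X \<rightarrow>\<^sub>E (SIGMA k:{..n}. bracket_power A a k))"
    using assms by (intro finite_PiE finite_SigmaI) (auto simp: bracket_power_def intro!: finite_PiE)
qed

lemma group_action_J_deg:
  fixes G (structure)
  assumes "group_action G X \<phi>"
  shows "group_action G (J_deg N A a X n) (map_action G X \<phi> (J_deg N A a X n))"
proof -
  interpret group_action G X \<phi> by fact
  interpret group_hom G "BijGroup X" \<phi> by (rule group_hom)
  let ?J = "J_deg N A a X n"
  let ?\<psi> = "map_action G X \<phi> ?J"
  have closed: "?\<psi> g f \<in> ?J" if g: "g \<in> carrier G" and f: "f \<in> ?J" for g f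
  proof -
    have bij: "bij_betw (\<phi> (inv g)) X X"
      using bij_prop0[of "inv g"] g by (auto simp: Bij_def)
    have "(\<Sum>x\<in>X. fst (f (\<phi> (inv g) x))) = (\<Sum>x\<in>X. fst (f x))"
      by (rule sum.reindex_bij_betw[OF bij])
    moreover have "f (\<phi> (inv g) x) \<in> S_set N A a" if "x \<in> X" for x
      using f bij_betw_apply[OF bij that] by (auto simp: J_deg_def J_set_def)
    ultimately show ?thesis
      using f by (auto simp: map_action_def J_deg_def J_set_def deg_def cong: sum.cong)
  qed
  have mult: "?\<psi> (g \<otimes> h) f = ?\<psi> g (?\<psi> h f)"
    if gh: "g \<in> carrier G" "h \<in> carrier G" and f: "f \<in> ?J" for g h f
  proof
    fix x
    have "\<phi> (inv (g \<otimes> h)) x = \<phi> (inv h) (\<phi> (inv g) x)" if "x \<in> X"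
      using gh that composition_rule[of x "inv h" "inv g"] by (simp add: G.inv_mult_group)
    moreover have "\<phi> (inv g) x \<in> X" if "x \<in> X"
      using gh that element_image[of "inv g" x] by auto
    ultimately show "?\<psi> (g \<otimes> h) f x = ?\<psi> g (?\<psi> h f) x"
      using closed[OF gh(2) f] f by (auto simp: map_action_def)
  qed
  have one: "?\<psi> \<one> f = f" if f: "f \<in> ?J" for f
  proof
    fix x
    have "\<phi> \<one> x = x" if "x \<in> X"
      using that id_eq_one by (metis restrict_apply')
    moreover have "f x = undefined" if "x \<notin> X"
      using f that by (auto simp: J_deg_def J_set_def)
    ultimately show "?\<psi> \<one> f x = f x"
      using f by (auto simp: map_action_def)
  qed
  have bij: "?\<psi> g \<in> Bij ?J" if g: "g \<in> carrier G" for g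
  proof -
    have "bij_betw (?\<psi> g) ?J ?J"
    proof (rule bij_betw_byWitness[where f' = "?\<psi> (inv g)"])
      show "\<forall>f\<in>?J. ?\<psi> (inv g) (?\<psi> g f) = f"
        using g mult[of "inv g" g] one by simp
      show "\<forall>f\<in>?J. ?\<psi> g (?\<psi> (inv g) f) = f"
        using g mult[of g "inv g"] one by simp
      show "?\<psi> g ` ?J \<subseteq> ?J" "?\<psi> (inv g) ` ?J \<subseteq> ?J"
        using closed g by blast+
    qed
    then show ?thesis by (auto simp: Bij_def map_action_def)
  qed
  have "?\<psi> (g \<otimes> h) = compose ?J (?\<psi> g) (?\<psi> h)"
    if gh: "g \<in> carrier G" "h \<in> carrier G" for g h
  proof
    fix f
    show "?\<psi> (g \<otimes> h) f = compose ?J (?\<psi> g) (?\<psi> h) f"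
      using mult[OF gh, of f] by (cases "f \<in> ?J") (simp_all add: compose_def, simp add: map_action_def)
  qed
  then have "?\<psi> \<in> hom G (BijGroup ?J)"
    using bij by (auto simp: hom_def BijGroup_def)
  then show ?thesis
    by (simp add: group_action_def group_hom_def group_hom_axioms_def G.is_group group_BijGroup)
qed

end

theory Submission
  imports Defs
begin

text \<open>
  A map on \<open>X\<close> is fixed by \<open>H\<close> iff it is constant on \<open>H\<close>-orbits, so the fixed points of \<open>J\<close> are the
  functions from the set of orbits to \<open>S\<^sub>N\<close>, an orbit \<open>U\<close> contributing \<open>card U\<close> times the degree of
  its value. The generating function of such functions is a product over the orbits; collecting the
  orbits of equal size gives the claim. Only the finitely many \<open>i \<le> card X\<close> contribute a
  nontrivial factor, so the infinite product is eventually constant.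
\<close>

text \<open>Weights add over the coordinates of a function, so its weight enumerators multiply:
  splitting off one coordinate turns the count into a Cauchy product. \<open>S\<close> itself may be
  infinite; only its level sets under each weight must be finite.\<close>

lemma fps_card_PiE_weight:
  fixes v :: "'u \<Rightarrow> 's \<Rightarrow> nat"
  assumes "finite P" "\<And>u k. u \<in> P \<Longrightarrow> finite {s \<in> S. v u s = k}"
  shows "Abs_fps (\<lambda>n. of_nat (card {F \<in> P \<rightarrow>\<^sub>E S. (\<Sum>u\<in>P. v u (F u)) = n}))
         = (\<Prod>u\<in>P. Abs_fps (\<lambda>k. of_nat (card {s \<in> S. v u s = k})) :: 'r::comm_semiring_1 fps)"
proof -
  define W where "W P n = {F \<in> P \<rightarrow>\<^sub>E S. (\<Sum>u\<in>P. v u (F u)) = n}" for P n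
  \<comment> \<open>Finiteness goes through the same induction, since an infinite
    \<open>W P n\<close> would get \<open>card\<close> 0 and spoil the count.\<close>
  have "(\<forall>n. finite (W P n)) \<and>
    Abs_fps (\<lambda>n. of_nat (card (W P n)))
      = (\<Prod>u\<in>P. Abs_fps (\<lambda>k. of_nat (card {s \<in> S. v u s = k})) :: 'r fps)"
    using assms
  proof (induction P rule: finite_induct)
    case empty
    have "W {} n = (if n = 0 then {\<lambda>_. undefined} else {})" for n
      by (auto simp: W_def)
    then show ?case by (auto simp: fps_eq_iff)
  next
    case (insert p P)
    note fin = insert.prems[of p, simplified]
    let ?V = "\<lambda>k. {s \<in> S. v p s = k}"
    \<comment> \<open>Triples: the weight of the value at \<open>p\<close>, that value, and the rest
      of the function. The weight is redundant, but indexing by it makes the cardinality a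
      convolution.\<close>
    let ?D = "\<lambda>n. SIGMA k:{..n}. ?V k \<times> W P (n - k)"
    have IH: "finite (W P n)"
      "Abs_fps (\<lambda>n. of_nat (card (W P n)))
        = (\<Prod>u\<in>P. Abs_fps (\<lambda>k. of_nat (card {s \<in> S. v u s = k})) :: 'r fps)" for n
      using insert.IH[OF insert.prems] by simp_all
    have upd: "(\<Sum>u\<in>P. v u ((F(p := s)) u)) = (\<Sum>u\<in>P. v u (F u))" for F s
      using insert.hyps by (intro sum.cong) auto
    have reset: "F(p := undefined) = F" if "F \<in> W P m" for F m
      using that insert.hyps by (intro fun_upd_idem) (auto simp: W_def PiE_def extensional_def)
    have bij: "bij_betw (\<lambda>(k, s, F). F(p := s)) (?D n) (W (insert p P) n)" for n
    proof (rule bij_betw_byWitness[where f' = "\<lambda>F. (v p (F p), F p, F(p := undefined))"])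
      show "\<forall>t\<in>?D n. (\<lambda>F. (v p (F p), F p, F(p := undefined))) ((\<lambda>(k, s, F). F(p := s)) t) = t"
        using reset by auto
      show "\<forall>F\<in>W (insert p P) n. (\<lambda>(k, s, F). F(p := s)) (v p (F p), F p, F(p := undefined)) = F"
        by simp
      show "(\<lambda>(k, s, F). F(p := s)) ` ?D n \<subseteq> W (insert p P) n"
        using insert.hyps upd by (auto simp: W_def PiE_iff extensional_def split: if_splits)
      show "(\<lambda>F. (v p (F p), F p, F(p := undefined))) ` W (insert p P) n \<subseteq> ?D n"
        using insert.hyps upd by (auto simp: W_def PiE_iff extensional_def)
    qed
    have finD: "finite (?D n)" for n
      using fin IH(1) by auto
    have "card (W (insert p P) n) = (\<Sum>k\<le>n. card (?V k) * card (W P (n - k)))" for n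
      using bij_betw_same_card[OF bij, of n] fin IH(1) by (simp add: card_cartesian_product)
    then have "Abs_fps (\<lambda>n. of_nat (card (W (insert p P) n)))
        = Abs_fps (\<lambda>k. of_nat (card (?V k))) * (Abs_fps (\<lambda>n. of_nat (card (W P n))) :: 'r fps)"
      by (simp add: fps_eq_iff fps_mult_nth atLeast0AtMost)
    then show ?case
      using insert.hyps IH(2) bij_betw_finite[OF bij] finD by simp
  qed
  then show ?thesis
    by (simp add: W_def)
qed

lemma finite_bracket_power: "finite A \<Longrightarrow> finite (bracket_power A a n)"
  by (auto simp: bracket_power_def intro!: finite_PiE)

text \<open>No case split on \<open>n\<close> is left: the special singleton at \<open>n = 0\<close>
  has the size of an empty power.\<close>

lemma card_bracket_power: "finite A \<Longrightarrow> card (bracket_power A a n) = card (A - {a}) ^ n"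
  by (auto simp: bracket_power_def card_image card_PiE)

text \<open>The set \<open>F\<close> lets a finite part of \<open>N\<close> stand in for
  \<open>N\<close> when a single coefficient is computed.\<close>

lemma S_set_degree_eq:
  assumes "{n \<in> N. i * n = k} = {n \<in> F. i * n = k}"
  shows "{s \<in> S_set N A a. i * fst s = k} = (SIGMA n:{n \<in> F. i * n = k}. bracket_power A a n)"
  unfolding assms[symmetric] by (auto simp: S_set_def)

lemma finite_S_set_degree:
  assumes "finite A" "i > 0"
  shows "finite {s \<in> S_set N A a. i * fst s = k}"
proof -
  have "finite {n \<in> N. i * n = k}"
    by (rule finite_subset[of _ "{..k}"]) (use assms(2) in \<open>auto simp: Suc_le_eq\<close>)
  then show ?thesis
    using assms(1) by (subst S_set_degree_eq[OF refl]) (auto intro!: finite_SigmaI finite_bracket_power)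
qed

text \<open>The \<open>n\<close>-th summand is a monomial of degree \<open>i * n\<close> whose
  coefficient counts the elements of degree \<open>n\<close>. Convergence of power series is checked
  coefficientwise, each coefficient of the partial sums being eventually constant.\<close>

lemma has_sum_degree_series:
  fixes A :: "'a set"
  assumes "finite A" "i > 0"
  shows "((\<lambda>n. (of_nat (card (A - {a})) * fps_X ^ i) ^ n) has_sum
           (Abs_fps (\<lambda>k. int (card {s \<in> S_set N A a. i * fst s = k})))) N"
  unfolding has_sum_def
proof (rule tendsto_fpsI)
  fix k
  let ?c = "card (A - {a})"
  have nth: "fps_nth ((of_nat ?c * fps_X ^ i) ^ n) k = (if i * n = k then int ?c ^ n else 0)" for n
    by (simp add: power_mult_distrib fps_of_nat[symmetric] fps_const_power power_mult[symmetric]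
        fps_X_power_nth)
  \<comment> \<open>As \<open>i > 0\<close>, only exponents \<open>n\<close> up to \<open>k\<close>
    can satisfy \<open>i * n = k\<close>, so coefficient \<open>k\<close> is settled once
    \<open>F\<close> contains \<open>N \<inter> {..k}\<close>.\<close>
  have "fps_nth (\<Sum>n\<in>F. (of_nat ?c * fps_X ^ i) ^ n) k
      = int (card {s \<in> S_set N A a. i * fst s = k})"
    if F: "finite F" "N \<inter> {..k} \<subseteq> F" "F \<subseteq> N" for F
  proof -
    have "{n \<in> N. i * n = k} = {n \<in> F. i * n = k}"
      using F assms(2) by (auto simp: subset_iff)
    then have "card {s \<in> S_set N A a. i * fst s = k} = (\<Sum>n\<in>{n \<in> F. i * n = k}. ?c ^ n)"
      using F(1) assms(1) by (simp add: S_set_degree_eq card_bracket_power finite_bracket_power)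
    then show ?thesis
      using F(1) by (simp add: fps_sum_nth nth sum.inter_filter if_distrib[of int] cong: if_cong)
  qed
  then show "\<forall>\<^sub>F F in finite_subsets_at_top N. fps_nth (\<Sum>n\<in>F. (of_nat ?c * fps_X ^ i) ^ n) k
      = fps_nth (Abs_fps (\<lambda>k. int (card {s \<in> S_set N A a. i * fst s = k}))) k"
    unfolding eventually_finite_subsets_at_top by (intro exI[of _ "N \<inter> {..k}"]) auto
qed

text \<open>Needed because \<open>has_prod\<close> with a nonzero limit must have that limit proved
  nonzero. Any \<open>n\<close> in \<open>N\<close> gives a positive coefficient at
  \<open>i * n\<close>, as \<open>A - {a}\<close> is non-empty.\<close>

lemma degree_series_nonzero:
  assumes "finite A" "card A \<ge> 2" "N \<noteq> {}" "i > 0"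
  shows "Abs_fps (\<lambda>k. int (card {s \<in> S_set N A a. i * fst s = k})) \<noteq> 0"
proof -
  obtain n where n: "n \<in> N" using assms(3) by auto
  have "card (A - {a}) > 0"
    using assms(1,2) by (auto simp: card_Diff_singleton_if)
  then have "bracket_power A a n \<noteq> {}"
    using card_bracket_power[OF assms(1), of a n] by (metis card.empty less_numeral_extra(3) zero_less_power)
  then have "{s \<in> S_set N A a. i * fst s = i * n} \<noteq> {}"
    using n by (auto simp: S_set_def)
  then have card: "card {s \<in> S_set N A a. i * fst s = i * n} \<noteq> 0"
    by (subst card_0_eq[OF finite_S_set_degree[OF assms(1,4)]])
  show ?thesis
  proof
    assume "Abs_fps (\<lambda>k. int (card {s \<in> S_set N A a. i * fst s = k})) = 0"
    then have "fps_nth (Abs_fps (\<lambda>k. int (card {s \<in> S_set N A a. i * fst s = k}))) (i * n) = 0"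
      by (simp only: fps_zero_nth)
    with card show False
      by (simp only: fps_nth_Abs_fps of_nat_eq_0_iff)
  qed
qed

text \<open>Composition with the orbit map is inverted by evaluation at one chosen point of each
  orbit. The weight \<open>card U\<close> appears because the composite repeats the value
  \<open>F U\<close> at every point of \<open>U\<close>.\<close>

lemma fixed_maps_bij_betw_orbit_functions:
  fixes G :: "('g, 'm) monoid_scheme" and E :: "'x set" and A :: "'a set"
  assumes "group_action G E \<phi>" "finite E" "subgroup H G"
  defines "P \<equiv> orbits (G\<lparr>carrier := H\<rparr>) E \<phi>"
  shows "bij_betw (\<lambda>F. \<lambda>x\<in>E. F (orbit (G\<lparr>carrier := H\<rparr>) \<phi> x))
    {F \<in> P \<rightarrow>\<^sub>E S_set N A a. (\<Sum>U\<in>P. card U * fst (F U)) = n}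
    {f \<in> J_deg N A a E n. \<forall>h\<in>H. map_action G E \<phi> (J_deg N A a E n) h f = f}"
    (is "bij_betw ?\<Phi> ?L ?R")
proof -
  let ?o = "orbit (G\<lparr>carrier := H\<rparr>) \<phi>"
  interpret group_action G E \<phi> by fact
  interpret H: group_action "G\<lparr>carrier := H\<rparr>" E \<phi>
    using induced_action[OF assms(3)] .
  interpret group G using group_hom group_hom.axioms(1) by auto
  have sub: "H \<subseteq> carrier G" using assms(3) by (rule subgroup.subset)
  have invH: "inv\<^bsub>G\<^esub> h \<in> H" if "h \<in> H" for h
    using assms(3) that by (rule subgroup.m_inv_closed)
  have o_eq: "?o x = {\<phi> h x | h. h \<in> H}" for x
    by (simp add: orbit_def)
  have o_in: "?o x \<in> P" if "x \<in> E" for x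
    using that by (auto simp: P_def orbits_def)
  \<comment> \<open>Distinct orbits are disjoint, so an orbit is the orbit of each of its
    points.\<close>
  have o_same: "?o x = U" if "U \<in> P" "x \<in> U" for x U
  proof -
    have "x \<in> E" using that H.orbits_coverture by (auto simp: P_def)
    then show ?thesis
      using H.disjoint_union[of "?o x" U] H.orbit_refl[of x] o_in that by (auto simp: P_def)
  qed
  have PE: "U \<subseteq> E" "U \<noteq> {}" if "U \<in> P" for U
    using that H.orbits_coverture H.orbit_refl by (auto simp: P_def orbits_def)
  \<comment> \<open>An arbitrary representative; the choice is immaterial for fixed maps, which are
    constant on orbits.\<close>
  define r where "r U = (SOME x. x \<in> U)" for U :: "'x set"
  have r: "r U \<in> U" "r U \<in> E" "?o (r U) = U" if "U \<in> P" for U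
  proof -
    show "r U \<in> U" unfolding r_def using PE(2)[OF that] by (simp add: some_in_eq)
    then show "r U \<in> E" "?o (r U) = U" using PE(1)[OF that] o_same[OF that] by auto
  qed
  have act: "\<phi> h x \<in> E" "?o (\<phi> h x) = ?o x" if "h \<in> H" "x \<in> E" for h x
  proof -
    show "\<phi> h x \<in> E" using that sub element_image by blast
    show "?o (\<phi> h x) = ?o x" using that by (intro o_same o_in) (auto simp: o_eq)
  qed
  \<comment> \<open>Stated for every \<open>F\<close>, not only for members of \<open>?L\<close>, so
    that it serves both inclusions below.\<close>
  have deg_eq: "deg E (\<lambda>x\<in>E. F (?o x)) = (\<Sum>U\<in>P. card U * fst (F U))"
    for F :: "'x set \<Rightarrow> nat \<times> ('a + (nat \<Rightarrow> 'a))"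
  proof -
    have "deg E (\<lambda>x\<in>E. F (?o x)) = (\<Sum>U\<in>P. \<Sum>x\<in>U. fst (F (?o x)))"
      using H.disjoint_sum[OF assms(2), of "\<lambda>x. fst (F (?o x))"] by (simp add: deg_def P_def)
    also have "\<dots> = (\<Sum>U\<in>P. card U * fst (F U))"
      by (intro sum.cong refl) (simp add: o_same)
    finally show ?thesis .
  qed
  have ext: "(\<lambda>x\<in>E. g x) = f \<longleftrightarrow> (\<forall>x\<in>E. g x = f x)"
    if "f \<in> J_deg N A a E n" for f g
  proof -
    have "f \<in> extensional E"
      using that by (auto simp: J_deg_def J_set_def PiE_def)
    then show ?thesis
      by (metis extensionalityI restrict_apply' restrict_extensional)
  qed
  have fixed_iff: "f \<in> ?R \<longleftrightarrow> f \<in> J_deg N A a E n \<and> (\<forall>h\<in>H. \<forall>x\<in>E. f (\<phi> h x) = f x)" for f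
  proof -
    have act_iff: "(map_action G E \<phi> (J_deg N A a E n) h f = f) \<longleftrightarrow> (\<forall>x\<in>E. f (\<phi> (inv\<^bsub>G\<^esub> h) x) = f x)"
      if "f \<in> J_deg N A a E n" for h
      using that by (simp add: map_action_def ext)
    have inv_iff: "(\<forall>h\<in>H. Q (inv\<^bsub>G\<^esub> h)) \<longleftrightarrow> (\<forall>h\<in>H. Q h)" for Q
      using invH sub by (metis inv_inv subsetD)
    show ?thesis
      using act_iff inv_iff[of "\<lambda>h. \<forall>x\<in>E. f (\<phi> h x) = f x"] by (simp cong: conj_cong)
  qed
  have const: "f (r (?o x)) = f x" if "f \<in> ?R" "x \<in> E" for f x
  proof -
    have "r (?o x) \<in> ?o x" using that by (intro r o_in)
    then show ?thesis using that fixed_iff by (auto simp: o_eq)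
  qed
  have restr: "(\<lambda>x\<in>E. (\<lambda>U\<in>P. f (r U)) (?o x)) = f" if "f \<in> ?R" for f
    using that const[OF that] o_in by (subst ext) auto
  show ?thesis
  proof (rule bij_betw_byWitness[where f' = "\<lambda>f. \<lambda>U\<in>P. f (r U)"])
    show "\<forall>F\<in>?L. (\<lambda>U\<in>P. ?\<Phi> F (r U)) = F"
    proof
      fix F assume "F \<in> ?L"
      then have "F \<in> extensional P" by (auto simp: PiE_def)
      then show "(\<lambda>U\<in>P. ?\<Phi> F (r U)) = F"
        using r by (intro extensionalityI[of _ P]) auto
    qed
    show "\<forall>f\<in>?R. ?\<Phi> (\<lambda>U\<in>P. f (r U)) = f"
      using restr by blast
    show "?\<Phi> ` ?L \<subseteq> ?R"
    proof (intro image_subsetI)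
      fix F assume F: "F \<in> ?L"
      have "?\<Phi> F \<in> J_deg N A a E n"
        using F o_in by (auto simp: J_deg_def J_set_def deg_eq)
      then show "?\<Phi> F \<in> ?R"
        unfolding fixed_iff using act by simp
    qed
    show "(\<lambda>f. \<lambda>U\<in>P. f (r U)) ` ?R \<subseteq> ?L"
    proof (intro image_subsetI)
      fix f assume f: "f \<in> ?R"
      then have J: "f \<in> E \<rightarrow>\<^sub>E S_set N A a" "deg E f = n"
        by (auto simp: J_deg_def J_set_def)
      have "(\<Sum>U\<in>P. card U * fst ((\<lambda>U\<in>P. f (r U)) U)) = n"
        using deg_eq[of "\<lambda>U\<in>P. f (r U)"] restr[OF f] J(2) by simp
      then show "(\<lambda>U\<in>P. f (r U)) \<in> ?L"
        using J(1) r(2) by auto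
    qed
  qed
qed

theorem theorem3p8:
  fixes G :: "('g, 'm) monoid_scheme"
    and A :: "'a set" and a :: 'a and N :: "nat set"
    and X :: "'x set" and \<phi> :: "'g \<Rightarrow> 'x \<Rightarrow> 'x" and H :: "'g set"
  assumes "group G" and "finite (carrier G)"
    and "finite A" and "card A \<ge> 2" and "a \<in> A"
    and "N \<noteq> {}"
    and "subgroup H G"
    and "group_action G X \<phi>" and "finite X"
  shows "(\<lambda>i. (\<Sum>\<^sub>\<infinity>n\<in>N. (of_nat (card (A - {a})) * fps_X ^ Suc i) ^ n)
                ^ orbit_count G X \<phi> H (Suc i))
           has_prod mark_series G X \<phi> H N A a"
proof -
  define P where "P = orbits (G\<lparr>carrier := H\<rparr>) X \<phi>"
  \<comment> \<open>The factor of a single orbit of size \<open>i\<close>, given by its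
    coefficients; it is identified with the infinite sum over \<open>N\<close> only at the
    end.\<close>
  define B where "B i = Abs_fps (\<lambda>k. int (card {s \<in> S_set N A a. i * fst s = k}))" for i
  interpret H: group_action "G\<lparr>carrier := H\<rparr>" X \<phi>
    using group_action.induced_action[OF assms(8,7)] .
  have sub: "U \<subseteq> X" "U \<noteq> {}" if "U \<in> P" for U
    using that H.orbits_coverture H.orbit_refl by (auto simp: P_def orbits_def)
  have finP: "finite P"
    using sub(1) assms(9) by (intro finite_subset[of P "Pow X"]) auto
  have card: "0 < card U" "card U \<le> card X" if "U \<in> P" for U
    using sub[OF that] assms(9) by (auto simp: card_gt_0_iff card_mono finite_subset)
  have "mark_series G X \<phi> H N A a
      = Abs_fps (\<lambda>n. int (card {F \<in> P \<rightarrow>\<^sub>E S_set N A a. (\<Sum>U\<in>P. card U * fst (F U)) = n}))"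
    unfolding mark_series_def mark_def P_def
    by (simp only: bij_betw_same_card[OF fixed_maps_bij_betw_orbit_functions[OF assms(8,9,7)]])
  also have "\<dots> = (\<Prod>U\<in>P. B (card U))"
    unfolding B_def
    using fps_card_PiE_weight[OF finP, of "S_set N A a" "\<lambda>U s. card U * fst s"]
      finite_S_set_degree[OF assms(3) card(1)] by simp
  finally have mark: "mark_series G X \<phi> H N A a = (\<Prod>U\<in>P. B (card U))" .
  \<comment> \<open>Orbit sizes lie between 1 and \<open>card X\<close>, so \<open>Suc j\<close> for
    \<open>j \<le> n\<close> reaches all of them. Grouping orbits by size gives the powers; sizes
    that do not occur contribute 1.\<close>
  have "(\<Prod>j\<le>n. B (Suc j) ^ orbit_count G X \<phi> H (Suc j)) = mark_series G X \<phi> H N A a"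
    if "card X \<le> n" for n
  proof -
    have "(\<Prod>j\<le>n. B (Suc j) ^ orbit_count G X \<phi> H (Suc j))
        = (\<Prod>i\<in>Suc ` {..n}. \<Prod>U | U \<in> P \<and> card U = i. B (card U))"
      by (simp add: prod.reindex orbit_count_def P_def)
    also have "\<dots> = (\<Prod>U\<in>P. B (card U))"
    proof (rule prod.group[OF finP])
      show "card ` P \<subseteq> Suc ` {..n}"
        using card that by (fastforce simp: image_iff gr0_conv_Suc)
    qed simp
    finally show ?thesis using mark by simp
  qed
  then have "(\<lambda>n. \<Prod>j\<le>n. B (Suc j) ^ orbit_count G X \<phi> H (Suc j))
      \<longlonglongrightarrow> mark_series G X \<phi> H N A a"
    by (intro tendsto_eventually eventually_sequentiallyI)
  \<comment> \<open>\<open>raw_has_prod\<close> demands a nonzero limit; power series over the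
    integers have no zero divisors, so nonzero factors suffice.\<close>
  moreover have "mark_series G X \<phi> H N A a \<noteq> 0"
    unfolding mark B_def
    using degree_series_nonzero[OF assms(3,4,6) card(1)] finP by (auto simp: prod_zero_iff)
  ultimately have "(\<lambda>i. B (Suc i) ^ orbit_count G X \<phi> H (Suc i)) has_prod mark_series G X \<phi> H N A a"
    by (simp add: has_prod_def raw_has_prod_def)
  moreover have "(\<Sum>\<^sub>\<infinity>n\<in>N. (of_nat (card (A - {a})) * fps_X ^ Suc i) ^ n) = B (Suc i)" for i
    unfolding B_def by (rule infsumI, rule has_sum_degree_series[OF assms(3)]) simp
  ultimately show ?thesis by simp
qed

end
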